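(* Let $G$ be a compact topological group and let $P$ be a subgroup of $\mathrm{Aut}(G)$, with closure $\overline P$ in $\mathrm{Aut}(G)$. Then $G\leftthreetimes P$ is minimal in each of the following cases: (1) $G$ is abelian; (2) $P$ is essential in $\overline{P}$ (e.g., $P$ is closed in $\mathrm{Aut}(G)$); (3) $P\cap \mathrm{Inn}(G)$ is essential in $\overline{P}\cap \mathrm{Inn}(G)$.
   Context: All topological groups are Hausdorff. $\mathrm{Aut}(G)$ is the group of all topological automorphisms of $G$, equipped with the compact-open topology, which makes it a topological group; $\mathrm{Inn}(G)$ is its subgroup of inner automorphisms. For a subgroup $P\leq \mathrm{Aut}(G)$ (with the subspace topology), $G\leftthreetimes P$ denotes the set $G\times P$ with the product topology and the multiplication $(x,f)(y,g)=(x\cdot f(y),\, f\circ g)$. A Hausdorff topological group is minimal if it does not admit a strictly coarser Hausdorff group topology. A subgroup $H$ of a topological group $K$ is essential in $K$ if $H\cap N$ is nontrivial for every nontrivial closed normal subgroup $N$ of $K$. *)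

theory Defs
  imports "HOL-Analysis.Analysis" "HOL-Algebra.Bij" "HOL-Algebra.Coset"
begin

locale topological_group = group G
  for G :: "('a, 'b) monoid_scheme" (structure) and T :: "'a topology" +
  assumes topspace_eq: "topspace T = carrier G"
    and continuous_mult: "continuous_map (prod_topology T T) T (\<lambda>(x, y). x \<otimes> y)"
    and continuous_inv: "continuous_map T T (\<lambda>x. inv x)"

locale hausdorff_topological_group = topological_group +
  assumes hausdorff: "Hausdorff_space T"

definition coarser_topology :: "'a topology \<Rightarrow> 'a topology \<Rightarrow> bool" where
  "coarser_topology T' T \<longleftrightarrow> topspace T' = topspace T \<and> (\<forall>U. openin T' U \<longrightarrow> openin T U)"

definition minimal_topological_group ::
    "('a, 'b) monoid_scheme \<Rightarrow> 'a topology \<Rightarrow> bool" where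
  "minimal_topological_group K T \<longleftrightarrow>
     hausdorff_topological_group K T \<and>
     \<not> (\<exists>T'. hausdorff_topological_group K T' \<and> coarser_topology T' T \<and> T' \<noteq> T)"

definition essential_subgroup ::
    "'a set \<Rightarrow> ('a, 'b) monoid_scheme \<Rightarrow> 'a topology \<Rightarrow> bool" where
  "essential_subgroup H K T \<longleftrightarrow>
     subgroup H K \<and>
     (\<forall>N. normal N K \<and> closedin T N \<and> N \<noteq> {\<one>\<^bsub>K\<^esub>} \<longrightarrow> H \<inter> N \<noteq> {\<one>\<^bsub>K\<^esub>})"

(* As in AutoGroup, automorphisms are extensional functions (undefined outside the carrier),
   so that equality of automorphisms is equality on G; the product is composition. *)
definition TopAut :: "('a, 'b) monoid_scheme \<Rightarrow> 'a topology \<Rightarrow> ('a \<Rightarrow> 'a) monoid" where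
  "TopAut G T = AutoGroup G \<lparr>carrier := {f \<in> auto G. homeomorphic_map T T f}\<rparr>"

(* The sets below form a subbase. The choice C = {} shows that the
   underlying space is all of Aut(G). *)
definition compact_open_Aut ::
    "('a, 'b) monoid_scheme \<Rightarrow> 'a topology \<Rightarrow> ('a \<Rightarrow> 'a) topology" where
  "compact_open_Aut G T =
     topology_generated_by
       {{f \<in> carrier (TopAut G T). f ` C \<subseteq> U} | C U. compactin T C \<and> openin T U}"

definition Inn :: "('a, 'b) monoid_scheme \<Rightarrow> ('a \<Rightarrow> 'a) set" where
  "Inn G = (\<lambda>g. \<lambda>x\<in>carrier G. g \<otimes>\<^bsub>G\<^esub> x \<otimes>\<^bsub>G\<^esub> inv\<^bsub>G\<^esub> g) ` carrier G"

definition semidirect ::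
    "('a, 'b) monoid_scheme \<Rightarrow> ('a \<Rightarrow> 'a) set \<Rightarrow> ('a \<times> ('a \<Rightarrow> 'a)) monoid" where
  "semidirect G P =
     \<lparr>carrier = carrier G \<times> P,
      mult = (\<lambda>(x, f) (y, g). (x \<otimes>\<^bsub>G\<^esub> f y, f \<otimes>\<^bsub>AutoGroup G\<^esub> g)),
      one = (\<one>\<^bsub>G\<^esub>, \<one>\<^bsub>AutoGroup G\<^esub>)\<rparr>"

definition semidirect_topology ::
    "('a, 'b) monoid_scheme \<Rightarrow> 'a topology \<Rightarrow> ('a \<Rightarrow> 'a) set \<Rightarrow> ('a \<times> ('a \<Rightarrow> 'a)) topology" where
  "semidirect_topology G T P = prod_topology T (subtopology (compact_open_Aut G T) P)"

(* For a subgroup K of Aut(G) with the subspace topology and H contained in K. *)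
definition essential_in_Aut ::
    "('a, 'b) monoid_scheme \<Rightarrow> 'a topology \<Rightarrow> ('a \<Rightarrow> 'a) set \<Rightarrow> ('a \<Rightarrow> 'a) set \<Rightarrow> bool" where
  "essential_in_Aut G T H K \<longleftrightarrow>
     essential_subgroup H (TopAut G T \<lparr>carrier := K\<rparr>) (subtopology (compact_open_Aut G T) K)"

end

theory Submission
  imports Defs
begin

text \<open>
  Let \<open>H = G \<times> P\<close> inside \<open>K = G \<times> Aut(G)\<close>, and let \<open>\<sigma>\<close> be a Hausdorff group topology on \<open>H\<close> coarser
  than the product topology \<open>\<tau>\<close>. The proof measures how far \<open>\<sigma>\<close> is from \<open>\<tau>\<close> by the set \<open>core\<close> of
  all points of \<open>K\<close> to which the \<open>\<sigma>\<close>-neighbourhoods of \<open>1\<close> still cluster in \<open>\<tau>\<close>, that is, the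
  intersection of their \<open>\<tau>\<close>-closures in \<open>K\<close>. It is a closed subgroup of \<open>K\<close>, it is normalised by the
  closure of \<open>H\<close>, and it meets \<open>H\<close> only in \<open>1\<close> because \<open>\<sigma>\<close> is Hausdorff.

  Conjugation makes \<open>K\<close> act on its compact normal subgroup \<open>G\<close>; the point \<open>(x, f)\<close> acts as
  \<open>y \<mapsto> x f(y) x\<inverse>\<close>. On \<open>G\<close> the topologies \<open>\<sigma>\<close> and \<open>\<tau>\<close> agree, by compactness, so the action of
  \<open>(H, \<sigma>)\<close> on \<open>G\<close> is jointly continuous and hence \<open>action: H \<rightarrow> Aut(G)\<close> is continuous already for \<open>\<sigma>\<close>
  (\<open>continuous_map_action_coarser\<close>). This has two consequences. Firstly, \<open>core\<close> lies in the kernel of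
  the action, so every \<open>(x, f)\<close> in it has \<open>f\<close> inner. Secondly, \<open>action: K \<rightarrow> Aut(G)\<close> is a proper map, so
  the \<open>\<sigma>\<close>-neighbourhoods of \<open>1\<close> are eventually close to a compact fibre and can only fail to shrink
  to \<open>1\<close> in \<open>\<tau>\<close> if they cluster at some other point of it; hence \<open>\<sigma> = \<tau>\<close> as soon as \<open>core\<close> is
  trivial (\<open>topology_eq_if_core_trivial\<close>).

  Now let \<open>N\<close> be the projection of \<open>core\<close> to \<open>Aut(G)\<close>. It is a closed subgroup of \<open>Inn(G)\<close>, contained in
  and normalised by the closure of \<open>P\<close>, and it meets \<open>P\<close> trivially. Each of the three hypotheses forces
  such an \<open>N\<close> to be trivial: \<open>Inn(G)\<close> is trivial if \<open>G\<close> is abelian, and the other two are essentiality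
  applied to \<open>N\<close>. If \<open>N\<close> is trivial then \<open>core\<close> is contained in \<open>H\<close>, hence trivial, and \<open>\<sigma> = \<tau>\<close>
  (\<open>minimal_semidirect\<close>).
\<close>

section \<open>Topological groups and their subgroups\<close>

lemma continuous_map_coarser:
  "coarser_topology S T \<Longrightarrow> continuous_map X T f \<Longrightarrow> continuous_map X S f"
  by (simp add: coarser_topology_def continuous_map_def)

context topological_group
begin

lemma continuous_map_mult:
  assumes "continuous_map X T f" and "continuous_map X T g"
  shows "continuous_map X T (\<lambda>x. f x \<otimes> g x)"
proof -
  have "continuous_map X (prod_topology T T) (\<lambda>x. (f x, g x))"
    using assms by (simp add: continuous_map_pairedI)
  then show ?thesis
    using continuous_map_compose [OF _ continuous_mult] by (fastforce simp: o_def)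
qed

lemma continuous_map_minv:
  assumes "continuous_map X T f"
  shows "continuous_map X T (\<lambda>x. inv (f x))"
  using continuous_map_compose [OF assms continuous_inv] by (simp add: o_def)

lemma continuous_map_const_carrier:
  assumes "a \<in> carrier G"
  shows "continuous_map X T (\<lambda>x. a)"
  using assms topspace_eq by simp

lemmas continuous_map_group_intros =
  continuous_map_mult continuous_map_minv continuous_map_const_carrier

lemma topological_group_subgroup:
  assumes H: "subgroup H G"
  shows "topological_group (G\<lparr>carrier := H\<rparr>) (subtopology T H)"
proof -
  interpret H: group "G\<lparr>carrier := H\<rparr>"
    using H by (simp add: subgroup.subgroup_is_group)
  have HG: "H \<subseteq> carrier G"
    using H subgroup.subset by blast
  have mult_H: "x \<otimes> y \<in> H" if "x \<in> H" "y \<in> H" for x y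
    using H that by (rule subgroup.m_closed)
  have inv_H: "inv x \<in> H" if "x \<in> H" for x
    using H that by (rule subgroup.m_inv_closed)
  let ?S = "subtopology T H"
  have top: "topspace ?S = H"
    using HG topspace_eq by auto
  have id: "continuous_map ?S T (\<lambda>x. x)"
    by (simp add: continuous_map_from_subtopology)
  show ?thesis
  proof
    show "topspace ?S = carrier (G\<lparr>carrier := H\<rparr>)"
      using top by simp
    have "continuous_map (prod_topology ?S ?S) T (\<lambda>z. fst z \<otimes> snd z)"
      using continuous_map_compose [OF continuous_map_fst id, of ?S]
        continuous_map_compose [OF continuous_map_snd id, of ?S]
      by (intro continuous_map_mult) (simp_all add: o_def)
    then show "continuous_map (prod_topology ?S ?S) ?S
                 (\<lambda>(x, y). x \<otimes>\<^bsub>G\<lparr>carrier := H\<rparr>\<^esub> y)"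
      using top mult_H by (simp add: continuous_map_in_subtopology case_prod_unfold Pi_iff)
    have "continuous_map ?S T (\<lambda>x. inv x)"
      by (intro continuous_map_minv id)
    then have "continuous_map ?S ?S (\<lambda>x. inv x)"
      using top inv_H by (simp add: continuous_map_in_subtopology Pi_iff)
    then show "continuous_map ?S ?S (\<lambda>x. inv\<^bsub>G\<lparr>carrier := H\<rparr>\<^esub> x)"
      by (rule continuous_map_eq) (use H top in simp)
  qed
qed

lemma subgroup_closure_of:
  assumes H: "subgroup H G"
  shows "subgroup (T closure_of H) G"
proof (rule subgroupI)
  have HG: "H \<subseteq> carrier G"
    using H subgroup.subset by blast
  show "T closure_of H \<subseteq> carrier G"
    using closure_of_subset_topspace topspace_eq by metis
  have mult_H: "x \<otimes> y \<in> H" if "x \<in> H" "y \<in> H" for x y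
    using H that by (rule subgroup.m_closed)
  have inv_H: "inv x \<in> H" if "x \<in> H" for x
    using H that by (rule subgroup.m_inv_closed)
  have "H \<subseteq> T closure_of H"
    using HG by (simp add: closure_of_subset topspace_eq)
  then show "T closure_of H \<noteq> {}"
    using H subgroup.one_closed by fastforce
  show "inv a \<in> T closure_of H" if a: "a \<in> T closure_of H" for a
  proof -
    have "m_inv G ` (T closure_of H) \<subseteq> T closure_of (m_inv G ` H)"
      using continuous_inv by (simp add: continuous_map_image_closure_subset)
    also have "\<dots> \<subseteq> T closure_of H"
      using inv_H by (intro closure_of_mono) auto
    finally show ?thesis
      using a by blast
  qed
  show "a \<otimes> b \<in> T closure_of H" if "a \<in> T closure_of H" "b \<in> T closure_of H" for a b
  proof -
    have "(\<lambda>(x, y). x \<otimes> y) ` (prod_topology T T closure_of (H \<times> H))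
          \<subseteq> T closure_of ((\<lambda>(x, y). x \<otimes> y) ` (H \<times> H))"
      using continuous_mult by (rule continuous_map_image_closure_subset)
    also have "\<dots> \<subseteq> T closure_of H"
      using mult_H by (intro closure_of_mono) auto
    finally show ?thesis
      using that by (force simp: closure_of_Times)
  qed
qed

lemma openin_left_translate:
  assumes a: "a \<in> carrier G" and S: "openin T S"
  shows "openin T {x \<in> carrier G. a \<otimes> x \<in> S}"
proof -
  have "continuous_map T T (\<lambda>x. a \<otimes> x)"
    using a by (intro continuous_map_group_intros) auto
  then show ?thesis
    using S topspace_eq by (simp add: continuous_map_def)
qed

text \<open>By translation, a group topology is determined by its neighbourhoods of the identity.\<close>
lemma openin_if_finer_at_one:
  assumes "topological_group G T'"
    and fine: "\<And>V. openin T V \<Longrightarrow> \<one> \<in> V \<Longrightarrow> \<exists>U. openin T' U \<and> \<one> \<in> U \<and> U \<subseteq> V"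
    and S: "openin T S"
  shows "openin T' S"
proof (subst openin_subopen, intro ballI)
  fix s assume s: "s \<in> S"
  interpret T': topological_group G T' by fact
  have sG: "s \<in> carrier G"
    using s S openin_subset topspace_eq by fastforce
  obtain U where U: "openin T' U" "\<one> \<in> U" "U \<subseteq> {x \<in> carrier G. s \<otimes> x \<in> S}"
    using fine [OF openin_left_translate [OF sG S]] s sG by auto
  have "openin T' {x \<in> carrier G. inv s \<otimes> x \<in> U}"
    using U sG by (intro T'.openin_left_translate) auto
  moreover have "s \<in> {x \<in> carrier G. inv s \<otimes> x \<in> U}"
    using U sG by simp
  moreover have "{x \<in> carrier G. inv s \<otimes> x \<in> U} \<subseteq> S"
  proof
    fix x assume "x \<in> {x \<in> carrier G. inv s \<otimes> x \<in> U}"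
    then have "x \<in> carrier G" "s \<otimes> (inv s \<otimes> x) \<in> S"
      using U by auto
    then show "x \<in> S"
      using sG by (simp flip: m_assoc)
  qed
  ultimately show "\<exists>W. openin T' W \<and> s \<in> W \<and> W \<subseteq> S"
    by (intro exI [of _ "{x \<in> carrier G. inv s \<otimes> x \<in> U}"] conjI)
qed

end

lemma (in hausdorff_topological_group) hausdorff_topological_group_subgroup:
  assumes "subgroup H G"
  shows "hausdorff_topological_group (G\<lparr>carrier := H\<rparr>) (subtopology T H)"
proof (intro hausdorff_topological_group.intro hausdorff_topological_group_axioms.intro)
  show "topological_group (G\<lparr>carrier := H\<rparr>) (subtopology T H)"
    using assms by (rule topological_group_subgroup)
  show "Hausdorff_space (subtopology T H)"
    using hausdorff by (rule Hausdorff_space_subtopology)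
qed

section \<open>Coarser group topologies on a subgroup\<close>

locale coarser_subgroup_topology = topological_group K \<tau>
  for K :: "('a, 'b) monoid_scheme" (structure) and \<tau> :: "'a topology" +
  fixes H :: "'a set" and \<sigma> :: "'a topology"
  assumes subgroup_H: "subgroup H K"
    and sigma: "hausdorff_topological_group (K\<lparr>carrier := H\<rparr>) \<sigma>"
    and coarser: "coarser_topology \<sigma> (subtopology \<tau> H)"
begin

sublocale sigma: hausdorff_topological_group "K\<lparr>carrier := H\<rparr>" \<sigma>
  by (rule sigma)

lemma H_subset: "H \<subseteq> carrier K"
  using subgroup_H subgroup.subset by blast

lemma topspace_sigma: "topspace \<sigma> = H"
  using sigma.topspace_eq by simp

lemma openin_sigma_subset: "openin \<sigma> U \<Longrightarrow> U \<subseteq> H"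
  using openin_subset topspace_sigma by blast

lemma one_in_H: "\<one> \<in> H"
  using subgroup_H subgroup.one_closed by blast

lemma inv_sigma [simp]: "x \<in> H \<Longrightarrow> inv\<^bsub>K\<lparr>carrier := H\<rparr>\<^esub> x = inv x"
  using subgroup_H by simp

text \<open>A point belongs to \<open>core\<close> iff some filter on \<open>H\<close> that converges to \<open>1\<close> in \<open>\<sigma>\<close> converges to that
  point in \<open>\<tau>\<close>. If \<open>\<sigma>\<close> is the topology inherited from a Hausdorff \<open>\<tau>\<close>, only \<open>1\<close> is such a point. When
  \<open>H\<close> is dense, \<open>core\<close> is the kernel of the extension of the identity map \<open>(H, \<tau>) \<rightarrow> (H, \<sigma>)\<close> to \<open>K\<close>,
  with values in the completion of \<open>(H, \<sigma>)\<close>.\<close>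
definition core :: "'a set" where
  "core = {m \<in> carrier K. \<forall>U. openin \<sigma> U \<longrightarrow> \<one> \<in> U \<longrightarrow> m \<in> \<tau> closure_of U}"

lemma one_in_core: "\<one> \<in> core"
proof -
  have "\<one> \<in> \<tau> closure_of U" if "openin \<sigma> U" "\<one> \<in> U" for U
    using that openin_sigma_subset H_subset closure_of_subset [of U \<tau>] topspace_eq by blast
  then show ?thesis
    by (simp add: core_def)
qed

lemma core_subset_closure: "core \<subseteq> \<tau> closure_of H"
  using one_in_H openin_topspace [of \<sigma>] by (auto simp: core_def topspace_sigma)

lemma closedin_core: "closedin \<tau> core"
proof -
  let ?\<U> = "{U. openin \<sigma> U \<and> \<one> \<in> U}"
  have H: "H \<in> ?\<U>"
    using one_in_H openin_topspace [of \<sigma>] by (simp add: topspace_sigma)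
  have "core = (\<Inter>U\<in>?\<U>. \<tau> closure_of U)"
  proof (intro equalityI subsetI)
    show "m \<in> (\<Inter>U\<in>?\<U>. \<tau> closure_of U)" if "m \<in> core" for m
      using that by (simp add: core_def)
    fix m assume m: "m \<in> (\<Inter>U\<in>?\<U>. \<tau> closure_of U)"
    then have "m \<in> \<tau> closure_of H"
      using H by (rule INT_D)
    then have "m \<in> carrier K"
      using closure_of_subset_topspace topspace_eq by (metis subsetD)
    then show "m \<in> core"
      using m by (simp add: core_def)
  qed
  moreover have "closedin \<tau> (\<Inter>U\<in>?\<U>. \<tau> closure_of U)"
    using H by (intro closedin_INT closedin_closure_of) auto
  ultimately show ?thesis
    by simp
qed

text \<open>Limits of quotients are quotients of limits: continuity of \<open>(x, y) \<mapsto> x y\<inverse>\<close> at \<open>(1, 1)\<close> in \<open>\<sigma>\<close>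
  provides the neighbourhoods, and its continuity in \<open>\<tau>\<close> carries their closures along.\<close>
lemma core_div:
  assumes a: "a \<in> core" and b: "b \<in> core"
  shows "a \<otimes> inv b \<in> core"
proof -
  have "a \<otimes> inv b \<in> \<tau> closure_of U" if U: "openin \<sigma> U" "\<one> \<in> U" for U
  proof -
    let ?d = "\<lambda>z. fst z \<otimes> inv (snd z)"
    define Z where "Z = {z \<in> H \<times> H. ?d z \<in> U}"
    have "continuous_map (prod_topology \<sigma> \<sigma>) \<sigma>
            (\<lambda>z. fst z \<otimes>\<^bsub>K\<lparr>carrier := H\<rparr>\<^esub> inv\<^bsub>K\<lparr>carrier := H\<rparr>\<^esub> (snd z))"
      by (intro sigma.continuous_map_group_intros continuous_map_fst continuous_map_snd)
    then have "continuous_map (prod_topology \<sigma> \<sigma>) \<sigma> ?d"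
      by (rule continuous_map_eq) (auto simp: topspace_sigma)
    then have open_Z: "openin (prod_topology \<sigma> \<sigma>) Z"
      using U by (simp add: continuous_map_def topspace_sigma Z_def)
    have "(\<one>, \<one>) \<in> Z"
      using U one_in_H by (simp add: Z_def)
    with open_Z obtain V W where V: "openin \<sigma> V" "\<one> \<in> V" and W: "openin \<sigma> W" "\<one> \<in> W"
      and VW: "V \<times> W \<subseteq> Z"
      unfolding openin_prod_topology_alt by metis
    have "continuous_map (prod_topology \<tau> \<tau>) \<tau> ?d"
      by (intro continuous_map_group_intros continuous_map_fst continuous_map_snd)
    then have "?d ` (prod_topology \<tau> \<tau> closure_of (V \<times> W)) \<subseteq> \<tau> closure_of (?d ` (V \<times> W))"
      by (rule continuous_map_image_closure_subset)
    also have "\<dots> \<subseteq> \<tau> closure_of U"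
      using VW by (intro closure_of_mono) (auto simp: Z_def)
    finally show ?thesis
      using a b V W by (force simp: closure_of_Times core_def)
  qed
  then show ?thesis
    using a b by (auto simp: core_def)
qed

lemma subgroup_core: "subgroup core K"
proof (rule subgroupI)
  show "core \<subseteq> carrier K"
    by (auto simp: core_def)
  show "core \<noteq> {}"
    using one_in_core by blast
  show inv: "inv a \<in> core" if "a \<in> core" for a
    using core_div [OF one_in_core that] that by (simp add: core_def)
  show "a \<otimes> b \<in> core" if "a \<in> core" "b \<in> core" for a b
    using core_div [OF that(1) inv [OF that(2)]] that by (simp add: core_def)
qed

lemma core_conj_H:
  assumes h: "h \<in> H" and a: "a \<in> core"
  shows "h \<otimes> a \<otimes> inv h \<in> core"
proof -
  have hK: "h \<in> carrier K"
    using h H_subset by blast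
  let ?d = "\<lambda>z. h \<otimes> z \<otimes> inv h"
  have "?d a \<in> \<tau> closure_of U" if U: "openin \<sigma> U" "\<one> \<in> U" for U
  proof -
    have "continuous_map \<sigma> \<sigma> (\<lambda>z. h \<otimes>\<^bsub>K\<lparr>carrier := H\<rparr>\<^esub> z \<otimes>\<^bsub>K\<lparr>carrier := H\<rparr>\<^esub>
            inv\<^bsub>K\<lparr>carrier := H\<rparr>\<^esub> h)"
      using h by (intro sigma.continuous_map_group_intros) auto
    then have "continuous_map \<sigma> \<sigma> ?d"
      by (rule continuous_map_eq) (use h in simp)
    then have V: "openin \<sigma> {z \<in> H. ?d z \<in> U}" (is "openin \<sigma> ?V")
      using U by (simp add: continuous_map_def topspace_sigma)
    have "\<one> \<in> ?V"
      using U hK one_in_H by simp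
    then have aV: "a \<in> \<tau> closure_of ?V"
      using a V by (simp add: core_def)
    have "continuous_map \<tau> \<tau> ?d"
      using hK by (intro continuous_map_group_intros) auto
    then have "?d ` (\<tau> closure_of ?V) \<subseteq> \<tau> closure_of (?d ` ?V)"
      by (rule continuous_map_image_closure_subset)
    also have "\<dots> \<subseteq> \<tau> closure_of U"
      by (intro closure_of_mono) auto
    finally show ?thesis
      using aV by blast
  qed
  then show ?thesis
    using a hK by (auto simp: core_def)
qed

text \<open>For a fixed core element the conjugators that keep it in the closed set \<open>core\<close> form a closed
  set, so normalisation by \<open>H\<close> extends to the closure of \<open>H\<close>.\<close>
lemma core_conj:
  assumes k: "k \<in> \<tau> closure_of H" and a: "a \<in> core"
  shows "k \<otimes> a \<otimes> inv k \<in> core"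
proof -
  let ?d = "\<lambda>z. z \<otimes> a \<otimes> inv z"
  have "continuous_map \<tau> \<tau> ?d"
    using a by (intro continuous_map_group_intros) (auto simp: core_def)
  then have "?d ` (\<tau> closure_of H) \<subseteq> \<tau> closure_of (?d ` H)"
    by (rule continuous_map_image_closure_subset)
  also have "\<dots> \<subseteq> core"
    using core_conj_H a closedin_core by (intro closure_of_minimal) auto
  finally show ?thesis
    using k by blast
qed

text \<open>A \<open>\<sigma>\<close>-neighbourhood of a point of \<open>H\<close> is also a \<open>\<tau>\<close>-neighbourhood within \<open>H\<close>, so separating
  that point from \<open>1\<close> in \<open>\<sigma>\<close> also keeps it outside a \<open>\<tau>\<close>-closure.\<close>
lemma core_Int_H: "core \<inter> H = {\<one>}"
proof -
  have "a = \<one>" if a: "a \<in> core" "a \<in> H" for a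
  proof (rule ccontr)
    assume "a \<noteq> \<one>"
    then obtain U V where UV: "openin \<sigma> U" "openin \<sigma> V" "\<one> \<in> U" "a \<in> V" "disjnt U V"
      using sigma.hausdorff a one_in_H topspace_sigma unfolding Hausdorff_space_def by metis
    then have "openin (subtopology \<tau> H) V"
      using coarser by (simp add: coarser_topology_def)
    then obtain W where W: "openin \<tau> W" "V = W \<inter> H"
      unfolding openin_subtopology by blast
    have "a \<in> \<tau> closure_of U"
      using a UV by (simp add: core_def)
    then obtain y where "y \<in> U" "y \<in> W"
      using UV W unfolding in_closure_of by blast
    then show False
      using UV W openin_sigma_subset by (force simp: disjnt_iff)
  qed
  then show ?thesis
    using one_in_core one_in_H by blast
qed

text \<open>A filter with \<open>\<sigma>\<close>-limit \<open>1\<close> and \<open>\<tau>\<close>-limit \<open>a\<close> is mapped by \<open>c\<close> to one that converges both to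
  \<open>c 1\<close> and to \<open>c a\<close>.\<close>
lemma core_subset_fibre:
  assumes c: "continuous_map \<tau> Y c" and cH: "continuous_map \<sigma> Y c" and Y: "Hausdorff_space Y"
    and a: "a \<in> core"
  shows "c a = c \<one>"
proof (rule ccontr)
  assume "c a \<noteq> c \<one>"
  have "a \<in> carrier K"
    using a by (simp add: core_def)
  moreover have "c a \<in> topspace Y" "c \<one> \<in> topspace Y"
    using c \<open>a \<in> carrier K\<close> topspace_eq by (auto simp: continuous_map_def)
  ultimately obtain U V where UV: "openin Y U" "openin Y V" "c \<one> \<in> U" "c a \<in> V" "disjnt U V"
    using Y \<open>c a \<noteq> c \<one>\<close> unfolding Hausdorff_space_def by metis
  have "openin \<sigma> {x \<in> H. c x \<in> U}"
    using cH UV by (simp add: continuous_map_def topspace_sigma)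
  then have *: "a \<in> \<tau> closure_of {x \<in> H. c x \<in> U}"
    using a UV one_in_H by (simp add: core_def)
  have "openin \<tau> {x \<in> carrier K. c x \<in> V}"
    using c UV by (simp add: continuous_map_def topspace_eq)
  moreover have "a \<in> {x \<in> carrier K. c x \<in> V}"
    using UV \<open>a \<in> carrier K\<close> by simp
  ultimately obtain y where "y \<in> {x \<in> H. c x \<in> U}" "y \<in> {x \<in> carrier K. c x \<in> V}"
    using * unfolding in_closure_of by meson
  then show False
    using UV by (auto simp: disjnt_iff)
qed

text \<open>Let \<open>O'\<close> be a \<open>\<tau>\<close>-neighbourhood of \<open>1\<close> and \<open>D\<close> the fibre of \<open>c\<close> through \<open>1\<close>. Every point of \<open>D\<close>
  other than \<open>1\<close> has a \<open>\<tau>\<close>-neighbourhood that misses some \<open>\<sigma>\<close>-neighbourhood of \<open>1\<close>, because the core is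
  trivial. By compactness of \<open>D\<close>, one \<open>\<sigma>\<close>-neighbourhood of \<open>1\<close> meets some open set \<open>W' \<supseteq> D\<close> only inside
  \<open>O'\<close>. Since \<open>c\<close> is closed, \<open>W'\<close> contains the full preimage of a neighbourhood \<open>Q\<close> of \<open>c 1\<close>; and since
  \<open>c\<close> is \<open>\<sigma>\<close>-continuous, the points of \<open>H\<close> that \<open>c\<close> maps into \<open>Q\<close> form another \<open>\<sigma>\<close>-neighbourhood of \<open>1\<close>.\<close>
lemma topology_eq_if_core_trivial:
  assumes c: "proper_map \<tau> Y c" and cH: "continuous_map \<sigma> Y c"
    and core: "core = {\<one>}"
  shows "\<sigma> = subtopology \<tau> H"
proof -
  have top: "topological_group (K\<lparr>carrier := H\<rparr>) (subtopology \<tau> H)"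
    using subgroup_H by (rule topological_group_subgroup)
  have fine: "\<exists>U. openin \<sigma> U \<and> \<one> \<in> U \<and> U \<subseteq> V"
    if "openin (subtopology \<tau> H) V" "\<one> \<in> V" for V
  proof -
    obtain O' where O': "openin \<tau> O'" "V = O' \<inter> H"
      using \<open>openin (subtopology \<tau> H) V\<close> unfolding openin_subtopology by blast
    define D where "D = {k \<in> carrier K. c k = c \<one>}"
    have c1: "c \<one> \<in> topspace Y"
      using c topspace_eq proper_map_imp_subset_topspace by fastforce
    have D: "compactin \<tau> D"
      using c c1 unfolding proper_map_def D_def topspace_eq by blast
    have "\<exists>U W. openin \<sigma> U \<and> \<one> \<in> U \<and> openin \<tau> W \<and> d \<in> W \<and> U \<inter> W \<subseteq> O'" if "d \<in> D" for d
    proof (cases "d = \<one>")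
      case True
      then show ?thesis
        using O' that one_in_H openin_topspace [of \<sigma>] topspace_sigma \<open>\<one> \<in> V\<close> by blast
    next
      case False
      then have "d \<notin> core" "d \<in> carrier K"
        using core that by (auto simp: D_def)
      then obtain U where U: "openin \<sigma> U" "\<one> \<in> U" "d \<notin> \<tau> closure_of U"
        by (auto simp: core_def)
      then obtain W where "openin \<tau> W" "d \<in> W" "U \<inter> W = {}"
        using \<open>d \<in> carrier K\<close> topspace_eq unfolding in_closure_of by blast
      then show ?thesis
        using U by blast
    qed
    then obtain U W where UW: "\<And>d. d \<in> D \<Longrightarrow> openin \<sigma> (U d) \<and> \<one> \<in> U d \<and> openin \<tau> (W d)
        \<and> d \<in> W d \<and> U d \<inter> W d \<subseteq> O'"
      by metis
    have "\<exists>\<F>. finite \<F> \<and> \<F> \<subseteq> W ` D \<and> D \<subseteq> \<Union>\<F>"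
    proof (rule compactinD [OF D])
      show "openin \<tau> X" if "X \<in> W ` D" for X
        using that UW by auto
      show "D \<subseteq> \<Union> (W ` D)"
        using UW by auto
    qed
    then obtain F where F: "finite F" "F \<subseteq> D" "D \<subseteq> (\<Union>d\<in>F. W d)"
      by (metis finite_subset_image)
    define W' where "W' = (\<Union>d\<in>F. W d)"
    have W': "openin \<tau> W'" "D \<subseteq> W'"
      using F UW by (auto simp: W'_def)
    \<comment> \<open>The values of \<open>c\<close> that are attained only inside \<open>W'\<close>.\<close>
    define Q where "Q = topspace Y - c ` (topspace \<tau> - W')"
    have "openin Y Q"
      using c W' unfolding proper_map_def closed_map_def Q_def by blast
    moreover have "c \<one> \<in> Q"
      using c1 W' unfolding Q_def D_def topspace_eq by force
    moreover have QW: "k \<in> W'" if "k \<in> carrier K" "c k \<in> Q" for k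
      using that by (auto simp: Q_def topspace_eq)
    ultimately have "openin \<sigma> {x \<in> H. c x \<in> Q}"
      using cH by (simp add: continuous_map_def topspace_sigma)
    moreover have "openin \<sigma> (H \<inter> \<Inter> (U ` F))"
      using F UW openin_topspace [of \<sigma>] topspace_sigma
      by (cases "F = {}") (auto intro!: openin_Int openin_Inter)
    ultimately have "openin \<sigma> ({x \<in> H. c x \<in> Q} \<inter> (H \<inter> \<Inter> (U ` F)))"
      by (rule openin_Int)
    moreover have "\<one> \<in> {x \<in> H. c x \<in> Q} \<inter> (H \<inter> \<Inter> (U ` F))"
      using F UW one_in_H \<open>c \<one> \<in> Q\<close> by blast
    moreover have "{x \<in> H. c x \<in> Q} \<inter> (H \<inter> \<Inter> (U ` F)) \<subseteq> V"
    proof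
      fix x assume x: "x \<in> {x \<in> H. c x \<in> Q} \<inter> (H \<inter> \<Inter> (U ` F))"
      then have "x \<in> W'"
        using QW H_subset by blast
      then obtain d where "d \<in> F" "x \<in> W d"
        by (auto simp: W'_def)
      then show "x \<in> V"
        using x F UW O' by blast
    qed
    ultimately show ?thesis
      by blast
  qed
  have "openin \<sigma> S" if "openin (subtopology \<tau> H) S" for S
    using topological_group.openin_if_finer_at_one [OF top sigma.topological_group_axioms _ that]
      fine by simp
  then show ?thesis
    using coarser unfolding coarser_topology_def topology_eq by blast
qed

end

section \<open>The automorphism group of a compact group\<close>

locale compact_group = hausdorff_topological_group +
  assumes compact: "compact_space T"
begin

abbreviation Aut where "Aut \<equiv> TopAut G T"
abbreviation CO where "CO \<equiv> compact_open_Aut G T"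

lemma Aut_iff: "f \<in> carrier Aut \<longleftrightarrow> f \<in> hom G G \<and> f \<in> Bij (carrier G) \<and> homeomorphic_map T T f"
  by (simp add: TopAut_def auto_def)

lemma Aut_closed: "f \<in> carrier Aut \<Longrightarrow> x \<in> carrier G \<Longrightarrow> f x \<in> carrier G"
  by (auto simp: Aut_iff hom_def)

lemma Aut_hom: "f \<in> carrier Aut \<Longrightarrow> x \<in> carrier G \<Longrightarrow> y \<in> carrier G \<Longrightarrow> f (x \<otimes> y) = f x \<otimes> f y"
  by (auto simp: Aut_iff hom_def)

lemma Aut_continuous: "f \<in> carrier Aut \<Longrightarrow> continuous_map T T f"
  by (simp add: Aut_iff homeomorphic_imp_continuous_map)

lemma Aut_eqI:
  assumes "f \<in> carrier Aut" "g \<in> carrier Aut" and "\<And>x. x \<in> carrier G \<Longrightarrow> f x = g x"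
  shows "f = g"
  using assms by (intro extensionalityI [of f "carrier G" g]) (auto simp: Aut_iff Bij_def)

lemma mult_AutoGroup:
  "f \<in> carrier Aut \<Longrightarrow> g \<in> carrier Aut \<Longrightarrow> f \<otimes>\<^bsub>AutoGroup G\<^esub> g = compose (carrier G) f g"
  by (simp add: AutoGroup_def BijGroup_def Aut_iff)

lemma mult_Aut_AutoGroup: "mult Aut = mult (AutoGroup G)"
  by (simp add: TopAut_def)

lemma one_Aut_AutoGroup: "\<one>\<^bsub>Aut\<^esub> = \<one>\<^bsub>AutoGroup G\<^esub>"
  by (simp add: TopAut_def)

lemma one_Aut: "\<one>\<^bsub>Aut\<^esub> = (\<lambda>x\<in>carrier G. x)"
  by (simp add: TopAut_def AutoGroup_def BijGroup_def)

lemma mult_Aut_apply: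
  "f \<in> carrier Aut \<Longrightarrow> g \<in> carrier Aut \<Longrightarrow> x \<in> carrier G \<Longrightarrow> (f \<otimes>\<^bsub>Aut\<^esub> g) x = f (g x)"
  by (simp add: mult_Aut_AutoGroup mult_AutoGroup compose_def)

lemma subgroup_Aut: "subgroup (carrier Aut) (AutoGroup G)"
proof (rule group.subgroupI [OF AutoGroup])
  interpret AG: group "AutoGroup G"
    by (rule AutoGroup)
  have auto: "auto G = carrier (AutoGroup G)"
    by (simp add: AutoGroup_def)
  show "carrier Aut \<subseteq> carrier (AutoGroup G)"
    by (auto simp: TopAut_def AutoGroup_def)
  have "homeomorphic_map T T (\<lambda>x\<in>carrier G. x)"
    by (rule homeomorphic_map_eq [of T T id]) (auto simp: topspace_eq homeomorphic_map_id)
  then show "carrier Aut \<noteq> {}"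
    using id_in_auto by (auto simp: TopAut_def)
  show "f \<otimes>\<^bsub>AutoGroup G\<^esub> g \<in> carrier Aut" if f: "f \<in> carrier Aut" and g: "g \<in> carrier Aut" for f g
  proof -
    have "homeomorphic_map T T (f \<circ> g)"
      using f g by (intro homeomorphic_map_compose) (auto simp: Aut_iff)
    then have "homeomorphic_map T T (f \<otimes>\<^bsub>AutoGroup G\<^esub> g)"
      by (rule homeomorphic_map_eq)
        (simp add: mult_AutoGroup [OF f g] compose_def topspace_eq)
    moreover have "f \<otimes>\<^bsub>AutoGroup G\<^esub> g \<in> auto G"
      using f g AG.m_closed [of f g] by (simp add: TopAut_def auto)
    ultimately show ?thesis
      by (simp add: TopAut_def)
  qed
  show "inv\<^bsub>AutoGroup G\<^esub> f \<in> carrier Aut" if f: "f \<in> carrier Aut" for f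
  proof -
    have fa: "f \<in> carrier (AutoGroup G)"
      using f by (simp add: TopAut_def auto)
    have fB: "f \<in> Bij (carrier G)"
      using f by (simp add: Aut_iff)
    have "inv\<^bsub>AutoGroup G\<^esub> f = inv\<^bsub>BijGroup (carrier G)\<^esub> f"
      unfolding AutoGroup_def
      using fa auto by (intro group.m_inv_consistent group_BijGroup subgroup_auto) simp
    then have inv: "inv\<^bsub>AutoGroup G\<^esub> f = (\<lambda>x\<in>carrier G. inv_into (carrier G) f x)"
      by (simp add: inv_BijGroup [OF fB])
    obtain g where g: "homeomorphic_maps T T f g"
      using f by (auto simp: Aut_iff homeomorphic_map_maps)
    have "homeomorphic_map T T g"
      using g by (simp add: homeomorphic_maps_map)
    then have "homeomorphic_map T T (inv\<^bsub>AutoGroup G\<^esub> f)"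
    proof (rule homeomorphic_map_eq)
      fix x assume "x \<in> topspace T"
      then have x: "x \<in> carrier G" "g x \<in> carrier G" "f (g x) = x"
        using g by (auto simp: homeomorphic_maps_def topspace_eq continuous_map_def)
      moreover have "inj_on f (carrier G)"
        using fB by (simp add: Bij_def bij_betw_def)
      ultimately show "g x = (inv\<^bsub>AutoGroup G\<^esub> f) x"
        using inv_into_f_f [of f "carrier G" "g x"] by (simp add: inv)
    qed
    moreover have "inv\<^bsub>AutoGroup G\<^esub> f \<in> auto G"
      using AG.inv_closed [OF fa] by (simp add: auto)
    ultimately show ?thesis
      by (simp add: TopAut_def)
  qed
qed

lemma Aut_eq: "Aut = AutoGroup G\<lparr>carrier := carrier Aut\<rparr>"
  by (simp add: TopAut_def)

lemma group_Aut: "group Aut"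
  using subgroup.subgroup_is_group [OF subgroup_Aut AutoGroup] by (simp flip: Aut_eq)

sublocale Aut: group Aut
  by (rule group_Aut)

lemma Aut_inv_apply:
  assumes "f \<in> carrier Aut" "x \<in> carrier G"
  shows "(inv\<^bsub>Aut\<^esub> f) (f x) = x" "f ((inv\<^bsub>Aut\<^esub> f) x) = x"
  using assms mult_Aut_apply [of "inv\<^bsub>Aut\<^esub> f" f x] mult_Aut_apply [of f "inv\<^bsub>Aut\<^esub> f" x]
  by (simp_all add: one_Aut)

lemma Aut_one_apply: "f \<in> carrier Aut \<Longrightarrow> f \<one> = \<one>"
  using Aut_hom [of f \<one> \<one>] Aut_closed [of f \<one>] by (metis l_cancel_one' one_closed l_one)

lemma topspace_CO: "topspace CO = carrier Aut"
proof -
  have "compactin T {}" "openin T {}"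
    by auto
  then show ?thesis
    unfolding compact_open_Aut_def topology_generated_by_topspace by fastforce
qed

lemma openin_CO:
  assumes "compactin T C" "openin T U"
  shows "openin CO {f \<in> carrier Aut. f ` C \<subseteq> U}"
  unfolding compact_open_Aut_def using assms by (intro topology_generated_by_Basis) blast

lemma continuous_map_CO_I:
  assumes F: "\<And>x. x \<in> topspace X \<Longrightarrow> F x \<in> carrier Aut"
    and op: "\<And>C U. compactin T C \<Longrightarrow> openin T U \<Longrightarrow> openin X {x \<in> topspace X. F x ` C \<subseteq> U}"
  shows "continuous_map X CO F"
  unfolding compact_open_Aut_def
proof (rule continuous_on_generated_topo)
  fix W assume "W \<in> {{f \<in> carrier Aut. f ` C \<subseteq> U} |C U. compactin T C \<and> openin T U}"
  then obtain C U where W: "W = {f \<in> carrier Aut. f ` C \<subseteq> U}" "compactin T C" "openin T U"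
    by auto
  then have "F -` W \<inter> topspace X = {x \<in> topspace X. F x ` C \<subseteq> U}"
    using F by auto
  then show "openin X (F -` W \<inter> topspace X)"
    using op W by simp
next
  have "F ` topspace X \<subseteq> topspace CO"
    using F by (auto simp: topspace_CO)
  then show "F ` topspace X \<subseteq> \<Union> {{f \<in> carrier Aut. f ` C \<subseteq> U} |C U. compactin T C \<and> openin T U}"
    by (simp add: compact_open_Aut_def)
qed

text \<open>One half of the exponential law for the compact-open topology, a form of the tube lemma. It
  reduces the continuity of composition, of \<open>x \<mapsto> inner_aut x\<close> and of \<open>action\<close> to that of maps into \<open>G\<close>.\<close>
lemma continuous_map_into_CO:
  assumes F: "\<And>x. x \<in> topspace X \<Longrightarrow> F x \<in> carrier Aut"
    and cont: "continuous_map (prod_topology X T) T (\<lambda>z. F (fst z) (snd z))"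
  shows "continuous_map X CO F"
proof (rule continuous_map_CO_I)
  fix C U assume C: "compactin T C" and U: "openin T U"
  define W where "W = {z \<in> topspace (prod_topology X T). F (fst z) (snd z) \<in> U}"
  have W: "openin (prod_topology X T) W"
    unfolding W_def using cont U by (rule openin_continuous_map_preimage)
  have CG: "C \<subseteq> topspace T"
    using C by (rule compactin_subset_topspace)
  show "openin X {x \<in> topspace X. F x ` C \<subseteq> U}"
  proof (subst openin_subopen, intro ballI)
    fix x assume x: "x \<in> {x \<in> topspace X. F x ` C \<subseteq> U}"
    then have "{x} \<times> C \<subseteq> W"
      using CG by (auto simp: W_def)
    then obtain A B where AB: "openin X A" "x \<in> A" "C \<subseteq> B" "A \<times> B \<subseteq> W"
      using tube_lemma_right [OF W C, of x] x by blast
    have "F y c \<in> U" if "y \<in> A" "c \<in> C" for y c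
    proof -
      have "(y, c) \<in> W"
        using AB that by blast
      then show ?thesis
        by (simp add: W_def)
    qed
    then have "A \<subseteq> {x \<in> topspace X. F x ` C \<subseteq> U}"
      using openin_subset [OF AB(1)] by auto
    then show "\<exists>A. openin X A \<and> x \<in> A \<and> A \<subseteq> {x \<in> topspace X. F x ` C \<subseteq> U}"
      using AB by (intro exI [of _ A]) simp
  qed
qed (rule F)

text \<open>The other half of the exponential law: a compact Hausdorff space is regular, so each point has
  arbitrarily small closed, hence compact, neighbourhoods on which an automorphism can be controlled.\<close>
lemma continuous_map_eval:
  "continuous_map (prod_topology CO T) T (\<lambda>z. fst z (snd z))"
  unfolding continuous_map_def
proof (intro conjI allI impI)
  show "(\<lambda>z. fst z (snd z)) \<in> topspace (prod_topology CO T) \<rightarrow> topspace T"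
    by (auto simp: topspace_CO topspace_eq Aut_closed)
  fix U assume U: "openin T U"
  define W where "W = {z \<in> topspace (prod_topology CO T). fst z (snd z) \<in> U}"
  have "\<exists>A B. openin CO A \<and> openin T B \<and> f \<in> A \<and> x \<in> B \<and> A \<times> B \<subseteq> W" if "(f, x) \<in> W" for f x
  proof -
    from that have f: "f \<in> carrier Aut" and x: "x \<in> carrier G" and fx: "f x \<in> U"
      by (auto simp: W_def topspace_CO topspace_eq)
    have "openin T {y \<in> topspace T. f y \<in> U}"
      using Aut_continuous [OF f] U by (rule openin_continuous_map_preimage)
    moreover have "neighbourhood_base_of (closedin T) T"
      using compact_Hausdorff_imp_regular_space [OF compact hausdorff]
      by (simp add: neighbourhood_base_of_closedin)
    ultimately obtain B C where B: "openin T B" "closedin T C" "x \<in> B" "B \<subseteq> C"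
      and C: "C \<subseteq> {y \<in> topspace T. f y \<in> U}"
      using x fx topspace_eq unfolding neighbourhood_base_of by (metis (no_types, lifting) CollectI)
    let ?A = "{f \<in> carrier Aut. f ` C \<subseteq> U}"
    have "openin CO ?A"
      using closedin_compact_space [OF compact B(2)] U by (rule openin_CO)
    moreover have "?A \<times> B \<subseteq> W"
      using B openin_subset [OF B(1)]
      by (auto simp: W_def topspace_CO image_subset_iff subset_iff)
    moreover have "f \<in> ?A"
      using f C by auto
    ultimately show ?thesis
      using B by (intro exI [of _ ?A] exI [of _ B]) simp
  qed
  then show "openin (prod_topology CO T) {z \<in> topspace (prod_topology CO T). fst z (snd z) \<in> U}"
    unfolding W_def [symmetric] openin_prod_topology_alt by simp
qed

lemma continuous_map_apply:
  assumes "continuous_map X CO F" "continuous_map X T h"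
  shows "continuous_map X T (\<lambda>x. F x (h x))"
  using continuous_map_compose [OF continuous_map_pairedI [OF assms] continuous_map_eval]
  by (simp add: o_def)

lemma Hausdorff_CO: "Hausdorff_space CO"
  unfolding Hausdorff_space_def
proof (intro allI impI)
  fix f g assume fg: "f \<in> topspace CO \<and> g \<in> topspace CO \<and> f \<noteq> g"
  then have f: "f \<in> carrier Aut" and g: "g \<in> carrier Aut"
    by (auto simp: topspace_CO)
  then obtain x where x: "x \<in> carrier G" "f x \<noteq> g x"
    using Aut_eqI fg by metis
  then obtain U V where UV: "openin T U" "openin T V" "f x \<in> U" "g x \<in> V" "disjnt U V"
    using hausdorff Aut_closed [OF f] Aut_closed [OF g] topspace_eq
    unfolding Hausdorff_space_def by metis
  let ?A = "\<lambda>U. {f \<in> carrier Aut. f ` {x} \<subseteq> U}"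
  have "compactin T {x}"
    using x topspace_eq by simp
  then have "openin CO (?A U)" "openin CO (?A V)"
    using UV openin_CO [of "{x}"] by blast+
  moreover have "disjnt (?A U) (?A V)"
    using UV by (auto simp: disjnt_iff)
  ultimately show "\<exists>U V. openin CO U \<and> openin CO V \<and> f \<in> U \<and> g \<in> V \<and> disjnt U V"
    using f g UV by (intro exI [of _ "?A U"] exI [of _ "?A V"]) simp
qed

text \<open>The inverse of \<open>f\<close> maps \<open>C\<close> into \<open>U\<close> iff \<open>f\<close> maps the complement of \<open>U\<close> into the complement of
  \<open>C\<close>. In a compact Hausdorff space complements exchange compact and open sets, so inversion permutes
  the subbase.\<close>
lemma continuous_map_inv_CO: "continuous_map CO CO (\<lambda>f. inv\<^bsub>Aut\<^esub> f)"
proof (rule continuous_map_CO_I)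
  show "inv\<^bsub>Aut\<^esub> f \<in> carrier Aut" if "f \<in> topspace CO" for f
    using that by (simp add: topspace_CO)
  fix C U assume C: "compactin T C" and U: "openin T U"
  have CG: "C \<subseteq> carrier G" and UG: "U \<subseteq> carrier G"
    using compactin_subset_topspace [OF C] openin_subset [OF U] topspace_eq by auto
  have "(inv\<^bsub>Aut\<^esub> f) ` C \<subseteq> U \<longleftrightarrow> f ` (carrier G - U) \<subseteq> carrier G - C" if f: "f \<in> carrier Aut" for f
  proof
    assume sub: "(inv\<^bsub>Aut\<^esub> f) ` C \<subseteq> U"
    show "f ` (carrier G - U) \<subseteq> carrier G - C"
    proof clarify
      fix x assume x: "x \<in> carrier G" "x \<notin> U"
      then have "(inv\<^bsub>Aut\<^esub> f) (f x) \<notin> U"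
        using Aut_inv_apply f by simp
      then have "f x \<notin> C"
        using sub by blast
      then show "f x \<in> carrier G - C"
        using f x Aut_closed by simp
    qed
  next
    assume sub: "f ` (carrier G - U) \<subseteq> carrier G - C"
    show "(inv\<^bsub>Aut\<^esub> f) ` C \<subseteq> U"
    proof (clarify, rule ccontr)
      fix x assume x: "x \<in> C" "(inv\<^bsub>Aut\<^esub> f) x \<notin> U"
      have "(inv\<^bsub>Aut\<^esub> f) x \<in> carrier G"
        using x CG f Aut_closed [of "inv\<^bsub>Aut\<^esub> f" x] by auto
      then have "f ((inv\<^bsub>Aut\<^esub> f) x) \<in> carrier G - C"
        using x sub by blast
      then show False
        using x f Aut_inv_apply(2) [of f x] subsetD [OF CG x(1)] by simp
    qed
  qed
  then have "{f \<in> topspace CO. (inv\<^bsub>Aut\<^esub> f) ` C \<subseteq> U}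
      = {f \<in> carrier Aut. f ` (carrier G - U) \<subseteq> carrier G - C}"
    by (simp add: topspace_CO cong: conj_cong)
  moreover have "compactin T (carrier G - U)"
    using U closedin_compact_space [OF compact closedin_diff [OF closedin_topspace]]
    by (simp add: topspace_eq)
  moreover have "openin T (carrier G - C)"
    using openin_diff [OF openin_topspace compactin_imp_closedin [OF hausdorff C]]
    by (simp add: topspace_eq)
  ultimately show "openin CO {f \<in> topspace CO. (inv\<^bsub>Aut\<^esub> f) ` C \<subseteq> U}"
    using openin_CO by simp
qed

lemma hausdorff_topological_group_Aut: "hausdorff_topological_group Aut CO"
proof
  show "topspace CO = carrier Aut"
    by (rule topspace_CO)
  show "continuous_map (prod_topology CO CO) CO (\<lambda>(f, g). f \<otimes>\<^bsub>Aut\<^esub> g)"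
  proof (rule continuous_map_into_CO)
    fix z assume z: "z \<in> topspace (prod_topology CO CO)"
    then show "(case z of (f, g) \<Rightarrow> f \<otimes>\<^bsub>Aut\<^esub> g) \<in> carrier Aut"
      by (auto simp: topspace_CO)
  next
    let ?X = "prod_topology (prod_topology CO CO) T"
    have "continuous_map ?X CO (\<lambda>z. fst (fst z))" "continuous_map ?X CO (\<lambda>z. snd (fst z))"
      using continuous_map_fst_of [OF continuous_map_fst, of CO CO T]
        continuous_map_snd_of [OF continuous_map_fst, of CO CO T] by (simp_all add: o_def)
    from continuous_map_apply [OF this(1) continuous_map_apply [OF this(2) continuous_map_snd]]
    have "continuous_map ?X T (\<lambda>z. fst (fst z) (snd (fst z) (snd z)))" .
    then show "continuous_map (prod_topology (prod_topology CO CO) T) T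
          (\<lambda>z. (case fst z of (f, g) \<Rightarrow> f \<otimes>\<^bsub>Aut\<^esub> g) (snd z))"
      by (rule continuous_map_eq) (auto simp: topspace_CO topspace_eq mult_Aut_apply)
  qed
  show "continuous_map CO CO (\<lambda>f. inv\<^bsub>Aut\<^esub> f)"
    by (rule continuous_map_inv_CO)
  show "Hausdorff_space CO"
    by (rule Hausdorff_CO)
qed

sublocale Aut: hausdorff_topological_group Aut CO
  by (rule hausdorff_topological_group_Aut)

end

context compact_group
begin

subsection \<open>Inner automorphisms\<close>

definition inner_aut :: "'a \<Rightarrow> 'a \<Rightarrow> 'a" where
  "inner_aut x = (\<lambda>y\<in>carrier G. x \<otimes> y \<otimes> inv x)"

lemma Inn_eq: "Inn G = inner_aut ` carrier G"
  by (simp add: Inn_def inner_aut_def)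

lemma inner_aut_apply: "y \<in> carrier G \<Longrightarrow> inner_aut x y = x \<otimes> y \<otimes> inv x"
  by (simp add: inner_aut_def)

lemma inner_aut_inv_apply:
  assumes "x \<in> carrier G" "y \<in> carrier G"
  shows "inner_aut x (inner_aut (inv x) y) = y"
proof -
  have "x \<otimes> (inv x \<otimes> y \<otimes> x) \<otimes> inv x = (x \<otimes> inv x) \<otimes> y \<otimes> (x \<otimes> inv x)"
    using assms by (simp only: m_assoc m_closed inv_closed)
  then show ?thesis
    using assms by (simp add: inner_aut_def)
qed

lemma continuous_map_inner_aut_apply:
  assumes "x \<in> carrier G"
  shows "continuous_map T T (inner_aut x)"
proof (rule continuous_map_eq)
  show "continuous_map T T (\<lambda>y. x \<otimes> y \<otimes> inv x)"
    using assms by (intro continuous_map_group_intros) auto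
qed (simp add: topspace_eq inner_aut_apply)

lemma inner_aut_closed:
  assumes x: "x \<in> carrier G"
  shows "inner_aut x \<in> carrier Aut"
proof -
  have "homeomorphic_maps T T (inner_aut x) (inner_aut (inv x))"
    using x continuous_map_inner_aut_apply inner_aut_inv_apply [of x] inner_aut_inv_apply [of "inv x"]
    by (simp add: homeomorphic_maps_def topspace_eq)
  then have homeo: "homeomorphic_map T T (inner_aut x)"
    using homeomorphic_maps_map by blast
  then have "bij_betw (inner_aut x) (carrier G) (carrier G)"
    using homeomorphic_eq_everything_map topspace_eq unfolding bij_betw_def by metis
  moreover have "inner_aut x \<in> hom G G"
  proof (rule homI)
    fix y z assume yz: "y \<in> carrier G" "z \<in> carrier G"
    show "inner_aut x y \<in> carrier G"
      using x yz by (simp add: inner_aut_apply)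
    have "x \<otimes> y \<otimes> inv x \<otimes> (x \<otimes> z \<otimes> inv x) = x \<otimes> y \<otimes> (inv x \<otimes> x) \<otimes> z \<otimes> inv x"
      using x yz by (simp only: m_assoc m_closed inv_closed)
    then show "inner_aut x (y \<otimes> z) = inner_aut x y \<otimes> inner_aut x z"
      using x yz by (simp add: inner_aut_apply m_assoc)
  qed
  ultimately show ?thesis
    using homeo by (simp add: Aut_iff Bij_def inner_aut_def)
qed

lemma inner_aut_mult:
  assumes "x \<in> carrier G" "y \<in> carrier G"
  shows "inner_aut (x \<otimes> y) = inner_aut x \<otimes>\<^bsub>Aut\<^esub> inner_aut y"
proof (rule Aut_eqI)
  fix z assume "z \<in> carrier G"
  then show "inner_aut (x \<otimes> y) z = (inner_aut x \<otimes>\<^bsub>Aut\<^esub> inner_aut y) z"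
    using assms by (simp add: mult_Aut_apply inner_aut_closed inner_aut_apply inv_mult_group m_assoc)
qed (use assms in \<open>simp_all add: inner_aut_closed\<close>)

lemma inner_aut_one: "inner_aut \<one> = \<one>\<^bsub>Aut\<^esub>"
  by (rule ext) (simp add: one_Aut inner_aut_def restrict_def)

lemma inner_aut_inv:
  assumes "x \<in> carrier G"
  shows "inner_aut (inv x) = inv\<^bsub>Aut\<^esub> (inner_aut x)"
proof (rule Aut.inv_equality [symmetric])
  show "inner_aut (inv x) \<otimes>\<^bsub>Aut\<^esub> inner_aut x = \<one>\<^bsub>Aut\<^esub>"
    using assms inner_aut_mult [of "inv x" x] by (simp add: inner_aut_one)
qed (use assms in \<open>simp_all add: inner_aut_closed\<close>)

lemma subgroup_Inn: "subgroup (Inn G) Aut"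
proof (rule Aut.subgroupI)
  show "Inn G \<subseteq> carrier Aut"
    by (auto simp: Inn_eq inner_aut_closed)
  show "Inn G \<noteq> {}"
    by (auto simp: Inn_eq)
  show "inv\<^bsub>Aut\<^esub> f \<in> Inn G" if "f \<in> Inn G" for f
    using that by (auto simp: Inn_eq simp flip: inner_aut_inv)
  show "f \<otimes>\<^bsub>Aut\<^esub> g \<in> Inn G" if "f \<in> Inn G" "g \<in> Inn G" for f g
    using that by (auto simp: Inn_eq simp flip: inner_aut_mult)
qed

lemma continuous_map_inner_aut: "continuous_map T CO inner_aut"
proof (rule continuous_map_into_CO)
  show "inner_aut x \<in> carrier Aut" if "x \<in> topspace T" for x
    using that by (simp add: topspace_eq inner_aut_closed)
  have "continuous_map (prod_topology T T) T (\<lambda>z. fst z \<otimes> snd z \<otimes> inv (fst z))"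
    by (intro continuous_map_mult continuous_map_minv continuous_map_fst continuous_map_snd)
  then show "continuous_map (prod_topology T T) T (\<lambda>z. inner_aut (fst z) (snd z))"
    by (rule continuous_map_eq) (auto simp: topspace_eq inner_aut_apply)
qed

section \<open>The semidirect product with the full automorphism group\<close>

abbreviation K where "K \<equiv> semidirect G (carrier Aut)"
abbreviation \<tau> where "\<tau> \<equiv> prod_topology T CO"

lemma carrier_K [simp]: "carrier K = carrier G \<times> carrier Aut"
  by (simp add: semidirect_def)

lemma mult_K [simp]: "(x, f) \<otimes>\<^bsub>K\<^esub> (y, g) = (x \<otimes> f y, f \<otimes>\<^bsub>Aut\<^esub> g)"
  by (simp add: semidirect_def mult_Aut_AutoGroup)

lemma one_K [simp]: "\<one>\<^bsub>K\<^esub> = (\<one>, \<one>\<^bsub>Aut\<^esub>)"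
  by (simp add: semidirect_def one_Aut_AutoGroup)

lemma one_Aut_apply [simp]: "x \<in> carrier G \<Longrightarrow> \<one>\<^bsub>Aut\<^esub> x = x"
  by (simp add: one_Aut)

lemma left_inv_K:
  assumes "x \<in> carrier G" "f \<in> carrier Aut"
  shows "((inv\<^bsub>Aut\<^esub> f) (inv x), inv\<^bsub>Aut\<^esub> f) \<otimes>\<^bsub>K\<^esub> (x, f) = \<one>\<^bsub>K\<^esub>"
proof -
  have "(inv\<^bsub>Aut\<^esub> f) (inv x) \<otimes> (inv\<^bsub>Aut\<^esub> f) x = (inv\<^bsub>Aut\<^esub> f) (inv x \<otimes> x)"
    using assms Aut_hom [of "inv\<^bsub>Aut\<^esub> f" "inv x" x] by (metis Aut.inv_closed inv_closed)
  then show ?thesis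
    using assms Aut_one_apply [of "inv\<^bsub>Aut\<^esub> f"] by simp
qed

lemma group_K: "group K"
proof (rule groupI)
  show "x \<otimes>\<^bsub>K\<^esub> y \<in> carrier K" if "x \<in> carrier K" "y \<in> carrier K" for x y
    using that by (auto simp: Aut_closed)
  show "\<one>\<^bsub>K\<^esub> \<in> carrier K"
    by simp
  show "x \<otimes>\<^bsub>K\<^esub> y \<otimes>\<^bsub>K\<^esub> z = x \<otimes>\<^bsub>K\<^esub> (y \<otimes>\<^bsub>K\<^esub> z)"
    if "x \<in> carrier K" "y \<in> carrier K" "z \<in> carrier K" for x y z
    using that by (auto simp: Aut_closed Aut_hom mult_Aut_apply m_assoc Aut.m_assoc)
  show "\<one>\<^bsub>K\<^esub> \<otimes>\<^bsub>K\<^esub> x = x" if "x \<in> carrier K" for x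
    using that by auto
  show "\<exists>y\<in>carrier K. y \<otimes>\<^bsub>K\<^esub> x = \<one>\<^bsub>K\<^esub>" if x: "x \<in> carrier K" for x
  proof -
    obtain a f where af: "x = (a, f)" "a \<in> carrier G" "f \<in> carrier Aut"
      using x by auto
    then have "((inv\<^bsub>Aut\<^esub> f) (inv a), inv\<^bsub>Aut\<^esub> f) \<in> carrier K"
      by (simp add: Aut_closed)
    then show ?thesis
      using left_inv_K [OF af(2,3)] af(1) by blast
  qed
qed

sublocale K: group K
  by (rule group_K)

lemma inv_K: "x \<in> carrier G \<Longrightarrow> f \<in> carrier Aut \<Longrightarrow>
    inv\<^bsub>K\<^esub> (x, f) = ((inv\<^bsub>Aut\<^esub> f) (inv x), inv\<^bsub>Aut\<^esub> f)"
  using left_inv_K [of x f] by (intro K.inv_equality) (auto simp: Aut_closed)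

lemma hausdorff_topological_group_K: "hausdorff_topological_group K \<tau>"
proof
  show "topspace \<tau> = carrier K"
    by (simp add: topspace_eq topspace_CO)
  show "Hausdorff_space \<tau>"
    using hausdorff Hausdorff_CO by (simp add: Hausdorff_space_prod_topology)
  have fst_cont: "continuous_map (prod_topology \<tau> \<tau>) T (\<lambda>z. fst (fst z))"
      "continuous_map (prod_topology \<tau> \<tau>) T (\<lambda>z. fst (snd z))"
    and snd_cont: "continuous_map (prod_topology \<tau> \<tau>) CO (\<lambda>z. snd (fst z))"
      "continuous_map (prod_topology \<tau> \<tau>) CO (\<lambda>z. snd (snd z))"
    using continuous_map_fst_of [OF continuous_map_fst, of T CO \<tau>]
      continuous_map_fst_of [OF continuous_map_snd, of \<tau> T CO]
      continuous_map_snd_of [OF continuous_map_fst, of T CO \<tau>]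
      continuous_map_snd_of [OF continuous_map_snd, of \<tau> T CO]
    by (simp_all add: o_def)
  have "continuous_map (prod_topology \<tau> \<tau>) \<tau>
          (\<lambda>z. (fst (fst z) \<otimes> snd (fst z) (fst (snd z)), snd (fst z) \<otimes>\<^bsub>Aut\<^esub> snd (snd z)))"
    by (intro continuous_map_pairedI continuous_map_mult Aut.continuous_map_mult fst_cont snd_cont
        continuous_map_apply [OF snd_cont(1) fst_cont(2)])
  then show "continuous_map (prod_topology \<tau> \<tau>) \<tau> (\<lambda>(x, y). x \<otimes>\<^bsub>K\<^esub> y)"
    by (rule continuous_map_eq) auto
  have inv_snd: "continuous_map \<tau> CO (\<lambda>z. inv\<^bsub>Aut\<^esub> (snd z))"
    by (intro Aut.continuous_map_minv continuous_map_snd)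
  have inv_fst: "continuous_map \<tau> T (\<lambda>z. inv (fst z))"
    by (intro continuous_map_minv continuous_map_fst)
  have "continuous_map \<tau> \<tau> (\<lambda>z. ((inv\<^bsub>Aut\<^esub> (snd z)) (inv (fst z)), inv\<^bsub>Aut\<^esub> (snd z)))"
    by (intro continuous_map_pairedI continuous_map_apply [OF inv_snd inv_fst] inv_snd)
  then show "continuous_map \<tau> \<tau> (\<lambda>x. inv\<^bsub>K\<^esub> x)"
    by (rule continuous_map_eq) (auto simp: inv_K topspace_eq topspace_CO)
qed

sublocale K: hausdorff_topological_group K \<tau>
  by (rule hausdorff_topological_group_K)

text \<open>The automorphism of \<open>G\<close> induced by conjugation with \<open>k\<close> in \<open>K\<close>, see \<open>conj_eq_action\<close>.\<close>
definition action :: "'a \<times> ('a \<Rightarrow> 'a) \<Rightarrow> 'a \<Rightarrow> 'a" where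
  "action k = inner_aut (fst k) \<otimes>\<^bsub>Aut\<^esub> snd k"

lemma action_in_Aut: "k \<in> carrier K \<Longrightarrow> action k \<in> carrier Aut"
  by (auto simp: action_def inner_aut_closed)

lemma conj_eq_action:
  assumes k: "k \<in> carrier K" and y: "y \<in> carrier G"
  shows "k \<otimes>\<^bsub>K\<^esub> (y, \<one>\<^bsub>Aut\<^esub>) \<otimes>\<^bsub>K\<^esub> inv\<^bsub>K\<^esub> k = (action k y, \<one>\<^bsub>Aut\<^esub>)"
proof -
  obtain x f where xf: "k = (x, f)" "x \<in> carrier G" "f \<in> carrier Aut"
    using k by auto
  have a: "action k y = x \<otimes> f y \<otimes> inv x"
    using xf y by (simp add: action_def mult_Aut_apply inner_aut_closed inner_aut_apply Aut_closed)
  have ac: "action k y \<in> carrier G"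
    using k y by (simp add: action_in_Aut Aut_closed del: carrier_K)
  \<comment> \<open>Moving \<open>k\<close> to the right-hand factor avoids the formula for its inverse.\<close>
  have "k \<otimes>\<^bsub>K\<^esub> (y, \<one>\<^bsub>Aut\<^esub>) = (action k y, \<one>\<^bsub>Aut\<^esub>) \<otimes>\<^bsub>K\<^esub> k"
    using xf y by (simp add: a [unfolded xf(1)] m_assoc Aut_closed)
  also have "\<dots> \<otimes>\<^bsub>K\<^esub> inv\<^bsub>K\<^esub> k = (action k y, \<one>\<^bsub>Aut\<^esub>)"
  proof -
    have "(action k y, \<one>\<^bsub>Aut\<^esub>) \<in> carrier K"
      using ac by simp
    then show ?thesis
      using k by (metis K.inv_closed K.m_assoc K.r_inv K.r_one)
  qed
  finally show ?thesis .
qed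

lemma proper_map_snd_\<tau>: "proper_map \<tau> CO snd"
  unfolding proper_map_def
proof (intro conjI ballI)
  show "closed_map \<tau> CO snd"
    using compact by (rule closed_map_snd)
  fix f assume "f \<in> topspace CO"
  then have "{z \<in> topspace \<tau>. snd z = f} = topspace T \<times> {f}"
    by auto
  then show "compactin \<tau> {z \<in> topspace \<tau>. snd z = f}"
    using compact \<open>f \<in> topspace CO\<close> by (simp add: compactin_Times compact_space_def)
qed

text \<open>The homeomorphism \<open>(x, f) \<mapsto> (x, inner_aut x \<circ> f)\<close> of \<open>K\<close> turns \<open>action\<close> into the projection to
  \<open>Aut(G)\<close>, which is proper because \<open>G\<close> is compact.\<close>
lemma proper_map_action: "proper_map \<tau> CO action"
proof -
  let ?\<phi> = "\<lambda>z. (fst z, inner_aut (fst z) \<otimes>\<^bsub>Aut\<^esub> snd z)"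
  let ?\<psi> = "\<lambda>z. (fst z, inner_aut (inv (fst z)) \<otimes>\<^bsub>Aut\<^esub> snd z)"
  have "continuous_map \<tau> CO (\<lambda>z. inner_aut (fst z))"
    using continuous_map_compose [OF continuous_map_fst continuous_map_inner_aut] by (simp add: o_def)
  then have \<phi>: "continuous_map \<tau> \<tau> ?\<phi>"
    by (intro continuous_map_pairedI continuous_map_fst Aut.continuous_map_mult continuous_map_snd)
  have "continuous_map \<tau> CO (\<lambda>z. inner_aut (inv (fst z)))"
    using continuous_map_compose [OF continuous_map_minv [OF continuous_map_fst] continuous_map_inner_aut]
    by (simp add: o_def)
  then have \<psi>: "continuous_map \<tau> \<tau> ?\<psi>"
    by (intro continuous_map_pairedI continuous_map_fst Aut.continuous_map_mult continuous_map_snd)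
  have cancel: "inner_aut x \<otimes>\<^bsub>Aut\<^esub> (inner_aut (inv x) \<otimes>\<^bsub>Aut\<^esub> f) = f"
    "inner_aut (inv x) \<otimes>\<^bsub>Aut\<^esub> (inner_aut x \<otimes>\<^bsub>Aut\<^esub> f) = f"
    if "x \<in> carrier G" "f \<in> carrier Aut" for x f
    using that by (simp_all add: inner_aut_inv inner_aut_closed flip: Aut.m_assoc)
  have "homeomorphic_maps \<tau> \<tau> ?\<phi> ?\<psi>"
    using \<phi> \<psi> cancel by (simp add: homeomorphic_maps_def topspace_eq topspace_CO)
  then have "homeomorphic_map \<tau> \<tau> ?\<phi>"
    using homeomorphic_maps_map by blast
  from proper_map_compose [OF homeomorphic_imp_proper_map [OF this] proper_map_snd_\<tau>]
  show ?thesis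
    by (simp add: o_def action_def [abs_def])
qed

lemma continuous_map_action: "continuous_map \<tau> CO action"
proof -
  have "continuous_map \<tau> CO (\<lambda>z. inner_aut (fst z))"
    using continuous_map_compose [OF continuous_map_fst continuous_map_inner_aut] by (simp add: o_def)
  then show ?thesis
    unfolding action_def [abs_def] by (intro Aut.continuous_map_mult continuous_map_snd)
qed

lemma subgroup_times:
  assumes P: "subgroup P Aut"
  shows "subgroup (carrier G \<times> P) K"
proof (rule K.subgroupI)
  have PA: "P \<subseteq> carrier Aut"
    using P subgroup.subset by blast
  show "carrier G \<times> P \<subseteq> carrier K"
    using PA by auto
  show "carrier G \<times> P \<noteq> {}"
    using subgroup.one_closed [OF P] by auto
  show "inv\<^bsub>K\<^esub> a \<in> carrier G \<times> P" if "a \<in> carrier G \<times> P" for a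
    using that PA by (auto simp: inv_K Aut_closed subgroup.m_inv_closed [OF P] subset_iff)
  show "a \<otimes>\<^bsub>K\<^esub> b \<in> carrier G \<times> P" if "a \<in> carrier G \<times> P" "b \<in> carrier G \<times> P" for a b
    using that PA by (auto simp: Aut_closed subgroup.m_closed [OF P] subset_iff)
qed

lemma semidirect_eq: "semidirect G P = K\<lparr>carrier := carrier G \<times> P\<rparr>"
  by (simp add: semidirect_def)

lemma semidirect_topology_eq: "semidirect_topology G T P = subtopology \<tau> (carrier G \<times> P)"
  by (simp add: semidirect_topology_def subtopology_Times subtopology_topspace flip: topspace_eq)

lemma coarser_subgroup_topology_K:
  assumes P: "subgroup P Aut"
    and \<sigma>: "hausdorff_topological_group (semidirect G P) \<sigma>"
    and coarser: "coarser_topology \<sigma> (semidirect_topology G T P)"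
  shows "coarser_subgroup_topology K \<tau> (carrier G \<times> P) \<sigma>"
proof (intro coarser_subgroup_topology.intro coarser_subgroup_topology_axioms.intro)
  show "topological_group K \<tau>"
    by (rule K.topological_group_axioms)
  show "subgroup (carrier G \<times> P) K"
    using P by (rule subgroup_times)
  show "hausdorff_topological_group (K\<lparr>carrier := carrier G \<times> P\<rparr>) \<sigma>"
    using \<sigma> by (simp only: semidirect_eq [of P])
  show "coarser_topology \<sigma> (subtopology \<tau> (carrier G \<times> P))"
    using coarser by (simp only: semidirect_topology_eq)
qed

text \<open>By the exponential law it suffices that \<open>(k, y) \<mapsto> action k y\<close> is continuous for \<open>\<sigma>\<close> and the
  topology of \<open>G\<close>. Composed with the inclusion \<open>G \<rightarrow> H\<close>, it becomes conjugation in the topological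
  group \<open>(H, \<sigma>)\<close>. The inclusion is a closed map from the compact space \<open>G\<close> to the Hausdorff space
  \<open>(H, \<sigma>)\<close>, so preimages of closed sets can be computed in \<open>H\<close>.\<close>
lemma continuous_map_action_coarser:
  assumes P: "subgroup P Aut"
    and \<sigma>: "hausdorff_topological_group (semidirect G P) \<sigma>"
    and coarser: "coarser_topology \<sigma> (semidirect_topology G T P)"
  shows "continuous_map \<sigma> CO action"
proof (rule continuous_map_into_CO)
  interpret S: coarser_subgroup_topology K \<tau> "carrier G \<times> P" \<sigma>
    using P \<sigma> coarser by (rule coarser_subgroup_topology_K)
  have HK: "k \<in> carrier K" if "k \<in> topspace \<sigma>" for k
    using that S.H_subset S.topspace_sigma by blast
  show "action k \<in> carrier Aut" if "k \<in> topspace \<sigma>" for k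
    using that HK action_in_Aut by blast
  let ?i = "\<lambda>y. (y, \<one>\<^bsub>Aut\<^esub>)"
  have one_P: "\<one>\<^bsub>Aut\<^esub> \<in> P"
    using P by (rule subgroup.one_closed)
  have "continuous_map T (subtopology \<tau> (carrier G \<times> P)) ?i"
    using one_P by (auto simp: continuous_map_in_subtopology continuous_map_pairedI topspace_CO
        topspace_eq)
  then have i: "continuous_map T \<sigma> ?i"
    by (rule continuous_map_coarser [OF coarser [unfolded semidirect_topology_eq]])
  then have closed: "closed_map T \<sigma> ?i"
    using compact S.sigma.hausdorff by (simp add: continuous_imp_closed_map)
  let ?j = "\<lambda>z. fst z \<otimes>\<^bsub>K\<^esub> ?i (snd z) \<otimes>\<^bsub>K\<^esub> inv\<^bsub>K\<^esub> (fst z)"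
  have "continuous_map (prod_topology \<sigma> T) \<sigma> (\<lambda>z. ?i (snd z))"
    using continuous_map_compose [OF continuous_map_snd i] by (simp add: o_def)
  then have "continuous_map (prod_topology \<sigma> T) \<sigma> (\<lambda>z.
      fst z \<otimes>\<^bsub>K\<lparr>carrier := carrier G \<times> P\<rparr>\<^esub> ?i (snd z) \<otimes>\<^bsub>K\<lparr>carrier := carrier G \<times> P\<rparr>\<^esub>
      inv\<^bsub>K\<lparr>carrier := carrier G \<times> P\<rparr>\<^esub> (fst z))"
    by (intro S.sigma.continuous_map_mult S.sigma.continuous_map_minv continuous_map_fst)
  then have j: "continuous_map (prod_topology \<sigma> T) \<sigma> ?j"
    by (rule continuous_map_eq) (auto simp: S.topspace_sigma)
  have j_eq: "?j z = ?i (action (fst z) (snd z))" if "z \<in> topspace (prod_topology \<sigma> T)" for z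
    using that HK [of "fst z"] by (intro conj_eq_action) (auto simp: topspace_eq)
  show "continuous_map (prod_topology \<sigma> T) T (\<lambda>z. action (fst z) (snd z))"
    unfolding continuous_map_closedin
  proof (intro conjI allI impI)
    show "(\<lambda>z. action (fst z) (snd z)) \<in> topspace (prod_topology \<sigma> T) \<rightarrow> topspace T"
      using HK action_in_Aut by (auto simp: topspace_eq Aut_closed)
    fix C assume "closedin T C"
    then have "closedin \<sigma> (?i ` C)"
      using closed by (simp add: closed_map_def)
    then have "closedin (prod_topology \<sigma> T) {z \<in> topspace (prod_topology \<sigma> T). ?j z \<in> ?i ` C}"
      using closedin_continuous_map_preimage [OF j] by blast
    moreover have "{z \<in> topspace (prod_topology \<sigma> T). ?j z \<in> ?i ` C}
        = {z \<in> topspace (prod_topology \<sigma> T). action (fst z) (snd z) \<in> C}"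
      by (rule Collect_cong) (use j_eq in auto)
    ultimately show "closedin (prod_topology \<sigma> T)
        {z \<in> topspace (prod_topology \<sigma> T). action (fst z) (snd z) \<in> C}"
      by simp
  qed
qed

section \<open>Minimality\<close>

text \<open>The subgroups \<open>N\<close> in the hypothesis are those that can arise as the projection to \<open>Aut(G)\<close> of the
  core of a coarser Hausdorff group topology. Once \<open>N\<close> is trivial, the core lies in \<open>G \<times> {1}\<close> and
  thus in \<open>G \<times> P\<close>, which it meets trivially.\<close>
lemma minimal_semidirect:
  assumes P: "subgroup P Aut"
    and trivial: "\<And>N. subgroup N Aut \<Longrightarrow> closedin CO N \<Longrightarrow> N \<subseteq> CO closure_of P \<Longrightarrow> N \<subseteq> Inn G
        \<Longrightarrow> (\<And>p f. p \<in> CO closure_of P \<Longrightarrow> f \<in> N \<Longrightarrow> p \<otimes>\<^bsub>Aut\<^esub> f \<otimes>\<^bsub>Aut\<^esub> inv\<^bsub>Aut\<^esub> p \<in> N)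
        \<Longrightarrow> P \<inter> N = {\<one>\<^bsub>Aut\<^esub>} \<Longrightarrow> N = {\<one>\<^bsub>Aut\<^esub>}"
  shows "minimal_topological_group (semidirect G P) (semidirect_topology G T P)"
  unfolding minimal_topological_group_def
proof (intro conjI notI)
  show "hausdorff_topological_group (semidirect G P) (semidirect_topology G T P)"
    unfolding semidirect_eq [of P] semidirect_topology_eq
    using subgroup_times [OF P] by (rule K.hausdorff_topological_group_subgroup)
  assume "\<exists>\<sigma>. hausdorff_topological_group (semidirect G P) \<sigma>
    \<and> coarser_topology \<sigma> (semidirect_topology G T P) \<and> \<sigma> \<noteq> semidirect_topology G T P"
  then obtain \<sigma> where \<sigma>: "hausdorff_topological_group (semidirect G P) \<sigma>"
    and coarser: "coarser_topology \<sigma> (semidirect_topology G T P)"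
    and ne: "\<sigma> \<noteq> semidirect_topology G T P"
    by blast
  let ?H = "carrier G \<times> P"
  interpret S: coarser_subgroup_topology K \<tau> ?H \<sigma>
    using P \<sigma> coarser by (rule coarser_subgroup_topology_K)
  have action: "continuous_map \<sigma> CO action"
    using P \<sigma> coarser by (rule continuous_map_action_coarser)
  have core_K: "S.core \<subseteq> carrier K"
    using S.subgroup_core by (rule subgroup.subset)
  have closure_H: "\<tau> closure_of ?H = carrier G \<times> CO closure_of P"
    by (simp add: closure_of_Times flip: topspace_eq)
  define N where "N = snd ` S.core"
  have snd_hom: "group_hom K Aut snd"
    by (intro group_hom.intro group_hom_axioms.intro group_K group_Aut homI) auto
  have NA: "subgroup N Aut"
    unfolding N_def using group_hom.subgroup_img_is_subgroup [OF snd_hom S.subgroup_core] .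
  have Ncl: "closedin CO N"
    unfolding N_def using closed_map_snd [OF compact, of CO] S.closedin_core by (simp add: closed_map_def)
  have NP: "N \<subseteq> CO closure_of P"
    using S.core_subset_closure by (auto simp: N_def closure_H)
  have NI: "N \<subseteq> Inn G"
  proof
    fix f assume "f \<in> N"
    then obtain x where xf: "(x, f) \<in> S.core"
      by (auto simp: N_def)
    then have x: "x \<in> carrier G" and f: "f \<in> carrier Aut"
      using core_K by auto
    have "action (x, f) = action \<one>\<^bsub>K\<^esub>"
      using continuous_map_action action Hausdorff_CO xf by (rule S.core_subset_fibre)
    then have "inner_aut x \<otimes>\<^bsub>Aut\<^esub> f = \<one>\<^bsub>Aut\<^esub>"
      by (simp add: action_def inner_aut_one)
    then have "f = inner_aut (inv x)"
      using x f by (metis Aut.inv_comm Aut.inv_equality inner_aut_closed inner_aut_inv)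
    then show "f \<in> Inn G"
      using x by (auto simp: Inn_eq)
  qed
  have Nn: "p \<otimes>\<^bsub>Aut\<^esub> f \<otimes>\<^bsub>Aut\<^esub> inv\<^bsub>Aut\<^esub> p \<in> N" if p: "p \<in> CO closure_of P" and f: "f \<in> N" for p f
  proof -
    obtain x where xf: "(x, f) \<in> S.core"
      using f by (auto simp: N_def)
    have pA: "p \<in> carrier Aut"
      using p closure_of_subset_topspace [of CO P] by (auto simp: topspace_CO)
    have "(\<one>, p) \<otimes>\<^bsub>K\<^esub> (x, f) \<otimes>\<^bsub>K\<^esub> inv\<^bsub>K\<^esub> (\<one>, p) \<in> S.core"
      using p xf by (intro S.core_conj) (simp_all add: closure_H)
    then have "snd ((\<one>, p) \<otimes>\<^bsub>K\<^esub> (x, f) \<otimes>\<^bsub>K\<^esub> inv\<^bsub>K\<^esub> (\<one>, p)) \<in> N"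
      unfolding N_def by (rule imageI)
    then show ?thesis
      using pA by (simp add: inv_K)
  qed
  have N1: "P \<inter> N = {\<one>\<^bsub>Aut\<^esub>}"
  proof (intro equalityI subsetI)
    fix f assume f: "f \<in> P \<inter> N"
    then obtain x where "(x, f) \<in> S.core"
      by (auto simp: N_def)
    then have "(x, f) \<in> S.core \<inter> ?H"
      using f core_K by auto
    then show "f \<in> {\<one>\<^bsub>Aut\<^esub>}"
      by (simp add: S.core_Int_H)
  next
    fix f assume "f \<in> {\<one>\<^bsub>Aut\<^esub>}"
    then show "f \<in> P \<inter> N"
      using subgroup.one_closed [OF P] subgroup.one_closed [OF NA] by simp
  qed
  have "N = {\<one>\<^bsub>Aut\<^esub>}"
    using NA Ncl NP NI Nn N1 by (rule trivial)
  then have "snd z \<in> P" if "z \<in> S.core" for z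
    using imageI [OF that, of snd] subgroup.one_closed [OF P] by (simp add: N_def)
  then have "S.core \<subseteq> ?H"
    using core_K by (auto simp: mem_Times_iff)
  then have "S.core = {\<one>\<^bsub>K\<^esub>}"
    using S.core_Int_H by (simp only: Int_absorb2)
  then have "\<sigma> = subtopology \<tau> ?H"
    using proper_map_action action by (intro S.topology_eq_if_core_trivial)
  then show False
    using ne by (simp add: semidirect_topology_eq)
qed

text \<open>With \<open>Q\<close> the closure of \<open>P\<close>, or its intersection with \<open>Inn(G)\<close>, this discharges the hypothesis
  of \<open>minimal_semidirect\<close>.\<close>
lemma essential_trivial:
  assumes Q: "subgroup Q Aut" and ess: "essential_in_Aut G T R Q" and RQ: "R \<subseteq> Q"
    and N: "subgroup N Aut" "closedin CO N" "N \<subseteq> Q"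
    and conj: "\<And>p f. p \<in> Q \<Longrightarrow> f \<in> N \<Longrightarrow> p \<otimes>\<^bsub>Aut\<^esub> f \<otimes>\<^bsub>Aut\<^esub> inv\<^bsub>Aut\<^esub> p \<in> N"
    and RN: "R \<inter> N = {\<one>\<^bsub>Aut\<^esub>}"
  shows "N = {\<one>\<^bsub>Aut\<^esub>}"
proof -
  let ?Q = "Aut\<lparr>carrier := Q\<rparr>"
  interpret Q: group ?Q
    using Q group_Aut by (simp add: subgroup.subgroup_is_group)
  have "N \<lhd> ?Q"
    unfolding Q.normal_inv_iff using Q N conj Aut.subgroup_incl [of N Q] by simp
  moreover have "closedin (subtopology CO Q) N"
    using N by (simp add: closedin_subset_topspace closedin_subtopology_Int_closed)
  ultimately show ?thesis
    using ess RN unfolding essential_in_Aut_def essential_subgroup_def by auto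
qed

end

theorem corollary5p3:
  fixes G :: "('a, 'b) monoid_scheme" and T :: "'a topology" and P :: "('a \<Rightarrow> 'a) set"
  assumes "hausdorff_topological_group G T"
    and "compact_space T"
    and "subgroup P (TopAut G T)"
  shows "(comm_group G \<longrightarrow>
            minimal_topological_group (semidirect G P) (semidirect_topology G T P)) \<and>
         (essential_in_Aut G T P (compact_open_Aut G T closure_of P) \<longrightarrow>
            minimal_topological_group (semidirect G P) (semidirect_topology G T P)) \<and>
         (closedin (compact_open_Aut G T) P \<longrightarrow>
            essential_in_Aut G T P (compact_open_Aut G T closure_of P)) \<and>
         (essential_in_Aut G T (P \<inter> Inn G) ((compact_open_Aut G T closure_of P) \<inter> Inn G) \<longrightarrow>
            minimal_topological_group (semidirect G P) (semidirect_topology G T P))"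
proof -
  interpret compact_group G T
    using assms by (simp add: compact_group_def compact_group_axioms_def)
  have P: "subgroup P Aut"
    by fact
  let ?P = "CO closure_of P"
  have P': "subgroup ?P Aut"
    using P by (rule Aut.subgroup_closure_of)
  have PP': "P \<subseteq> ?P"
    using subgroup.subset [OF P] by (simp add: closure_of_subset topspace_CO)
  show ?thesis
  proof (intro conjI impI)
    assume "comm_group G"
    then have "comm_monoid G"
      by (rule comm_group.axioms)
    have Inn: "Inn G = {\<one>\<^bsub>Aut\<^esub>}"
    proof -
      have "inner_aut x = \<one>\<^bsub>Aut\<^esub>" if x: "x \<in> carrier G" for x
      proof (rule Aut_eqI)
        fix y assume y: "y \<in> carrier G"
        have "x \<otimes>\<^bsub>G\<^esub> y = y \<otimes>\<^bsub>G\<^esub> x"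
          using \<open>comm_monoid G\<close> x y by (rule comm_monoid.m_comm)
        then show "inner_aut x y = \<one>\<^bsub>Aut\<^esub> y"
          using x y by (simp add: inner_aut_apply m_assoc)
      qed (use x in \<open>simp_all add: inner_aut_closed\<close>)
      then show ?thesis
        using one_closed by (auto simp: Inn_eq)
    qed
    show "minimal_topological_group (semidirect G P) (semidirect_topology G T P)"
    proof (rule minimal_semidirect [OF P])
      fix N assume "subgroup N Aut" "N \<subseteq> Inn G"
      then show "N = {\<one>\<^bsub>Aut\<^esub>}"
        using Inn subgroup.one_closed by blast
    qed
  next
    assume ess: "essential_in_Aut G T P ?P"
    show "minimal_topological_group (semidirect G P) (semidirect_topology G T P)"
      using P by (rule minimal_semidirect) (rule essential_trivial [OF P' ess PP'])
  next
    assume "closedin CO P"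
    then have "?P = P"
      by (simp add: closure_of_closedin)
    moreover have "subgroup P (Aut\<lparr>carrier := P\<rparr>)"
      using P by (intro Aut.subgroup_incl) auto
    moreover have "P \<inter> N = N" if "N \<lhd> (Aut\<lparr>carrier := P\<rparr>)" for N
      using subgroup.subset [OF normal_imp_subgroup [OF that]] by auto
    ultimately show "essential_in_Aut G T P ?P"
      by (auto simp: essential_in_Aut_def essential_subgroup_def)
  next
    assume ess: "essential_in_Aut G T (P \<inter> Inn G) (?P \<inter> Inn G)"
    show "minimal_topological_group (semidirect G P) (semidirect_topology G T P)"
    proof (rule minimal_semidirect [OF P])
      fix N assume N: "subgroup N Aut" "closedin CO N" "N \<subseteq> ?P" "N \<subseteq> Inn G"
        and conj: "\<And>p f. p \<in> ?P \<Longrightarrow> f \<in> N \<Longrightarrow> p \<otimes>\<^bsub>Aut\<^esub> f \<otimes>\<^bsub>Aut\<^esub> inv\<^bsub>Aut\<^esub> p \<in> N"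
        and PN: "P \<inter> N = {\<one>\<^bsub>Aut\<^esub>}"
      show "N = {\<one>\<^bsub>Aut\<^esub>}"
      proof (rule essential_trivial [OF _ ess])
        show "subgroup (?P \<inter> Inn G) Aut"
          using P' subgroup_Inn by (rule Aut.subgroups_Inter_pair)
        show "P \<inter> Inn G \<inter> N = {\<one>\<^bsub>Aut\<^esub>}"
          using PN N by auto
      qed (use N conj PP' in auto)
    qed
  qed
qed

end
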